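(* Let $S$ be a pseudogroup on a topological space $A$. Let $X$ be a Hausdorff $S$-modeled space. Let $G$ be a group with a topological $S$-preserving partial action on $X$. Suppose that $G$ transfixes $X$. Then there exist a Hausdorff $S$-modeled space $X'$ endowed with an $S$-preserving continuous $G$-action, and a cofinite $S$-preserving $G$-biequivariant isomorphism $\psi$ from $X$ to $X'$, given by cofinite subsets $Y\subset X$, $Y'\subset X'$ and $\psi:Y\to Y'$. Moreover, we can require that every finite $G$-orbit in $X'$ is included in $Y'$.
   Context: Partial homeomorphisms: $\mathcal{I}_{\mathrm{top}}(A,B)$ is the set of homeomorphisms between an open subset of $A$ and an open subset of $B$, viewed as subsets of $A\times B$; these compose as partial maps; $\mathcal{I}_{\mathrm{top}}(A)=\mathcal{I}_{\mathrm{top}}(A,A)$; $u\subset v$ means $v$ extends $u$. Pseudogroup: a pseudogroup on $A$ is a subset $S\subset\mathcal{I}_{\mathrm{top}}(A)$ containing $\mathrm{id}_A$, stable under composition and $u\mapsto u^{-1}$, such that $\{U:\mathrm{id}_U\in S\}$ is a basis of the topology of $A$. $\hat S$ is the set of elements of $\mathcal{I}_{\mathrm{top}}(A)$ that are unions of elements of $S$. An $S$-atlas on a topological space $X$ is a subset $\mathcal{H}\subset\mathcal{I}_{\mathrm{top}}(X,A)$ (charts), with $\emptyset\in\mathcal{H}$, whose domains cover $X$, such that $g\circ f^{-1}\in\hat S$ for all $f,g\in\mathcal{H}$. It is complete if $u\circ f\in\mathcal H$ for all $f\in\mathcal H$, $u\in S$, and every union of elements of $\mathcal{H}$ that belongs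 to $\mathcal{I}_{\mathrm{top}}(X,A)$ is in $\mathcal{H}$. An $S$-structure on $X$ is a complete $S$-atlas (every $S$-atlas generates one), and $X$ is then called $S$-modeled. $\mathcal{I}_S(X)$, the set of $S$-preserving partial homeomorphisms, consists of elements of $\mathcal{I}_{\mathrm{top}}(X)$ that are unions of elements $g^{-1}\circ f$ with $f,g\in\mathcal{H}$ (and similarly between two $S$-modeled spaces; an isomorphism of $S$-modeled spaces is an $S$-preserving homeomorphism). Partial actions: a topological partial action of a discrete group $G$ on $X$ is a map $\alpha:G\to\mathcal{I}_{\mathrm{top}}(X)$ with $\alpha(1)=\mathrm{id}_X$, $\alpha(g^{-1})=\alpha(g)^{-1}$, $\alpha(g)\alpha(h)\subset\alpha(gh)$; it is $S$-preserving if valued in $\mathcal{I}_S(X)$. It restricts to any open subset $Y$ by $g\mapsto\alpha(g)\cap Y^2$. Its universal globalization $\hat X$ is the quotient of $G\times X$ by the relation $(h,x)\sim(k,y)$ iff $\alpha(k^{-1}h)(x)$ is defined and equals $y$, with the $G$-action induced by $g\cdot(h,x)=(gh,x)$; $X$ embeds by $x\mapsto[(1,x)]$. $G$ transfixes $X$ if there is a $G$-invariant subset $X_0\subset\hat X$ with $X\bigtriangleup X_0$ finite. A bijection $\psi:(Y,\beta)\to(Y',\beta')$ between partial $G$-sets is $G$-biequivariant if for all $g$, $(\psi\times\psi)(\beta(g))=\beta'(g)$ as graphs. A cofinite $S$-preserving $G$-biequivariant isomorphism from $X$ to $X'$ is the data of cofinite subsets $Y\subset X$, $Y'\subset X'$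 (with the restricted partial actions) and a $G$-biequivariant isomorphism $\psi:Y\to Y'$ of $S$-modeled spaces. *)

theory Defs
  imports "HOL-Analysis.Analysis" "HOL-Algebra.Group_Action"
begin

section \<open>Partial homeomorphisms\<close>

text \<open>Partial maps are represented by their graphs. Hence \<open>u \<subseteq> v\<close> is extension of partial maps,
  the composite \<open>v \<circ> u\<close> (first \<open>u\<close>, then \<open>v\<close>) is the relation \<open>u O v\<close>, the inverse is the
  converse relation, and the identity of \<open>U\<close> is \<open>Id_on U\<close>.\<close>

definition fun_graph :: "'a set \<Rightarrow> ('a \<Rightarrow> 'b) \<Rightarrow> ('a \<times> 'b) set" where
  "fun_graph U f = (\<lambda>x. (x, f x)) ` U"

definition I_top :: "'a topology \<Rightarrow> 'b topology \<Rightarrow> ('a \<times> 'b) set set" where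
  "I_top A B = {fun_graph U f | U V f. openin A U \<and> openin B V \<and>
     homeomorphic_map (subtopology A U) (subtopology B V) f}"


section \<open>Pseudogroups and modeled spaces\<close>

definition pseudogroup :: "'a topology \<Rightarrow> ('a \<times> 'a) set set \<Rightarrow> bool" where
  "pseudogroup A S \<longleftrightarrow>
     S \<subseteq> I_top A A \<and>
     Id_on (topspace A) \<in> S \<and>
     (\<forall>u\<in>S. \<forall>v\<in>S. u O v \<in> S) \<and>
     (\<forall>u\<in>S. u\<inverse> \<in> S) \<and>
     openin A = arbitrary union_of (\<lambda>U. Id_on U \<in> S)"

definition pg_hat :: "'a topology \<Rightarrow> ('a \<times> 'a) set set \<Rightarrow> ('a \<times> 'a) set set" where
  "pg_hat A S = {v \<in> I_top A A. \<exists>T\<subseteq>S. v = \<Union>T}"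

definition S_atlas ::
  "'a topology \<Rightarrow> ('a \<times> 'a) set set \<Rightarrow> 'x topology \<Rightarrow> ('x \<times> 'a) set set \<Rightarrow> bool" where
  "S_atlas A S X H \<longleftrightarrow>
     H \<subseteq> I_top X A \<and>
     {} \<in> H \<and>
     (\<Union>f\<in>H. Domain f) = topspace X \<and>
     (\<forall>f\<in>H. \<forall>g\<in>H. f\<inverse> O g \<in> pg_hat A S)"

definition S_structure ::
  "'a topology \<Rightarrow> ('a \<times> 'a) set set \<Rightarrow> 'x topology \<Rightarrow> ('x \<times> 'a) set set \<Rightarrow> bool" where
  "S_structure A S X H \<longleftrightarrow>
     S_atlas A S X H \<and>
     (\<forall>f\<in>H. \<forall>u\<in>S. f O u \<in> H) \<and>
     (\<forall>F\<subseteq>H. \<Union>F \<in> I_top X A \<longrightarrow> \<Union>F \<in> H)"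

definition I_S ::
  "'x topology \<Rightarrow> ('x \<times> 'a) set set \<Rightarrow> 'y topology \<Rightarrow> ('y \<times> 'a) set set \<Rightarrow> ('x \<times> 'y) set set" where
  "I_S X H Y K = {u \<in> I_top X Y. \<exists>T \<subseteq> {f O g\<inverse> | f g. f \<in> H \<and> g \<in> K}. u = \<Union>T}"

text \<open>For open \<open>Y\<close>, the structure induced on \<open>Y\<close> by a complete atlas \<open>H\<close> consists of the
  charts of \<open>H\<close> that are defined inside \<open>Y\<close>.\<close>

definition restrict_structure :: "('x \<times> 'a) set set \<Rightarrow> 'x set \<Rightarrow> ('x \<times> 'a) set set" where
  "restrict_structure H Y = {f \<in> H. Domain f \<subseteq> Y}"

definition modeled_iso ::
  "'x topology \<Rightarrow> ('x \<times> 'a) set set \<Rightarrow> 'y topology \<Rightarrow> ('y \<times> 'a) set set \<Rightarrow> ('x \<Rightarrow> 'y) \<Rightarrow> bool" where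
  "modeled_iso X H Y K \<psi> \<longleftrightarrow>
     homeomorphic_map X Y \<psi> \<and> fun_graph (topspace X) \<psi> \<in> I_S X H Y K"


section \<open>Partial actions\<close>

definition topological_partial_action ::
  "('g, 'm) monoid_scheme \<Rightarrow> 'x topology \<Rightarrow> ('g \<Rightarrow> ('x \<times> 'x) set) \<Rightarrow> bool" where
  "topological_partial_action G X \<alpha> \<longleftrightarrow>
     (\<forall>g\<in>carrier G. \<alpha> g \<in> I_top X X) \<and>
     \<alpha> \<one>\<^bsub>G\<^esub> = Id_on (topspace X) \<and>
     (\<forall>g\<in>carrier G. \<alpha> (inv\<^bsub>G\<^esub> g) = (\<alpha> g)\<inverse>) \<and>
     (\<forall>g\<in>carrier G. \<forall>h\<in>carrier G. \<alpha> h O \<alpha> g \<subseteq> \<alpha> (g \<otimes>\<^bsub>G\<^esub> h))"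

definition S_preserving ::
  "('g, 'm) monoid_scheme \<Rightarrow> 'x topology \<Rightarrow> ('x \<times> 'a) set set \<Rightarrow> ('g \<Rightarrow> ('x \<times> 'x) set) \<Rightarrow> bool" where
  "S_preserving G X H \<alpha> \<longleftrightarrow> (\<forall>g\<in>carrier G. \<alpha> g \<in> I_S X H X H)"

definition restrict_partial_action ::
  "('g \<Rightarrow> ('x \<times> 'x) set) \<Rightarrow> 'x set \<Rightarrow> 'g \<Rightarrow> ('x \<times> 'x) set" where
  "restrict_partial_action \<alpha> Y g = \<alpha> g \<inter> (Y \<times> Y)"

text \<open>A genuine action viewed as a partial action, all of whose maps are everywhere defined.\<close>

definition action_graph :: "'x topology \<Rightarrow> ('g \<Rightarrow> 'x \<Rightarrow> 'x) \<Rightarrow> 'g \<Rightarrow> ('x \<times> 'x) set" where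
  "action_graph X \<phi> g = fun_graph (topspace X) (\<phi> g)"

text \<open>The acting group is discrete, so continuity of an action is continuity of each of its maps.\<close>

definition continuous_action ::
  "('g, 'm) monoid_scheme \<Rightarrow> 'x topology \<Rightarrow> ('g \<Rightarrow> 'x \<Rightarrow> 'x) \<Rightarrow> bool" where
  "continuous_action G X \<phi> \<longleftrightarrow>
     group_action G (topspace X) \<phi> \<and> (\<forall>g\<in>carrier G. continuous_map X X (\<phi> g))"


section \<open>The universal globalization and transfixing\<close>

definition glob_rel ::
  "('g, 'm) monoid_scheme \<Rightarrow> 'x topology \<Rightarrow> ('g \<Rightarrow> ('x \<times> 'x) set) \<Rightarrow> (('g \<times> 'x) \<times> ('g \<times> 'x)) set" where
  "glob_rel G X \<alpha> = {((h, x), (k, y)) | h x k y.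
     h \<in> carrier G \<and> k \<in> carrier G \<and> x \<in> topspace X \<and> y \<in> topspace X \<and>
     (x, y) \<in> \<alpha> (inv\<^bsub>G\<^esub> k \<otimes>\<^bsub>G\<^esub> h)}"

definition globalization ::
  "('g, 'm) monoid_scheme \<Rightarrow> 'x topology \<Rightarrow> ('g \<Rightarrow> ('x \<times> 'x) set) \<Rightarrow> ('g \<times> 'x) set set" where
  "globalization G X \<alpha> = (carrier G \<times> topspace X) // glob_rel G X \<alpha>"

text \<open>The relation is invariant under left translation of the first coordinate, so the image of
  a class under left translation is again a class.\<close>

definition glob_act :: "('g, 'm) monoid_scheme \<Rightarrow> 'g \<Rightarrow> ('g \<times> 'x) set \<Rightarrow> ('g \<times> 'x) set" where
  "glob_act G g C = (\<lambda>(h, x). (g \<otimes>\<^bsub>G\<^esub> h, x)) ` C"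

definition glob_embed ::
  "('g, 'm) monoid_scheme \<Rightarrow> 'x topology \<Rightarrow> ('g \<Rightarrow> ('x \<times> 'x) set) \<Rightarrow> 'x \<Rightarrow> ('g \<times> 'x) set" where
  "glob_embed G X \<alpha> x = glob_rel G X \<alpha> `` {(\<one>\<^bsub>G\<^esub>, x)}"

definition transfixes ::
  "('g, 'm) monoid_scheme \<Rightarrow> 'x topology \<Rightarrow> ('g \<Rightarrow> ('x \<times> 'x) set) \<Rightarrow> bool" where
  "transfixes G X \<alpha> \<longleftrightarrow>
     (\<exists>X0 \<subseteq> globalization G X \<alpha>.
        (\<forall>g\<in>carrier G. \<forall>C\<in>X0. glob_act G g C \<in> X0) \<and>
        finite (sym_diff (glob_embed G X \<alpha> ` topspace X) X0))"


section \<open>Cofinite biequivariant isomorphisms\<close>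

definition biequivariant ::
  "('g, 'm) monoid_scheme \<Rightarrow> ('g \<Rightarrow> ('x \<times> 'x) set) \<Rightarrow> ('g \<Rightarrow> ('y \<times> 'y) set) \<Rightarrow> ('x \<Rightarrow> 'y) \<Rightarrow> bool" where
  "biequivariant G \<beta> \<beta>' \<psi> \<longleftrightarrow> (\<forall>g\<in>carrier G. map_prod \<psi> \<psi> ` \<beta> g = \<beta>' g)"

text \<open>A cofinite subset of a Hausdorff space is open, so the induced structures below make sense
  there.\<close>

definition cofinite_biequivariant_iso ::
  "('g, 'm) monoid_scheme \<Rightarrow>
   'x topology \<Rightarrow> ('x \<times> 'a) set set \<Rightarrow> ('g \<Rightarrow> ('x \<times> 'x) set) \<Rightarrow>
   'y topology \<Rightarrow> ('y \<times> 'a) set set \<Rightarrow> ('g \<Rightarrow> ('y \<times> 'y) set) \<Rightarrow>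
   'x set \<Rightarrow> 'y set \<Rightarrow> ('x \<Rightarrow> 'y) \<Rightarrow> bool" where
  "cofinite_biequivariant_iso G X H \<alpha> X' H' \<alpha>' Y Y' \<psi> \<longleftrightarrow>
     Y \<subseteq> topspace X \<and> finite (topspace X - Y) \<and>
     Y' \<subseteq> topspace X' \<and> finite (topspace X' - Y') \<and>
     modeled_iso (subtopology X Y) (restrict_structure H Y)
       (subtopology X' Y') (restrict_structure H' Y') \<psi> \<and>
     biequivariant G (restrict_partial_action \<alpha> Y) (restrict_partial_action \<alpha>' Y') \<psi>"

end

theory Submission
  imports Defs
begin

text \<open>Let \<open>X0\<close> be an invariant subset of the globalization that differs from \<open>X\<close> by a finite
  set. A cofinite subset of the Hausdorff space \<open>X\<close> is open, so \<open>X0\<close> is covered by translates of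
  an open subset of \<open>X\<close> and thereby inherits a topology and an \<open>S\<close>-structure; it may fail to be
  Hausdorff. Remove from \<open>X0\<close> the finite orbits that are not contained in \<open>X\<close>; there are finitely
  many, since each of them meets the finite set \<open>F = X0 - X\<close>. Two points \<open>p\<close>, \<open>q\<close> of what
  remains that cannot be separated have no common translate in \<open>X\<close>, so for every \<open>g\<close> one of
  \<open>g p\<close>, \<open>g q\<close> lies in \<open>F\<close>. By Neumann's lemma one of the two orbits is finite, hence contained
  in \<open>X\<close>; then the orbit of the other point is contained in \<open>F\<close>, so it is finite as well and
  should have been removed.\<close>

section \<open>The calculus of partial homeomorphisms\<close>

lemma Image_fun_graph: "fun_graph U f `` W = f ` (U \<inter> W)"
  by (auto simp: fun_graph_def)

lemma converse_Image_fun_graph: "(fun_graph U f)\<inverse> `` W = {x \<in> U. f x \<in> W}"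
  by (auto simp: fun_graph_def)

lemma fun_graph_in_I_top:
  assumes "openin A U" "openin B V"
    and "homeomorphic_map (subtopology A U) (subtopology B V) f"
  shows "fun_graph U f \<in> I_top A B"
  using assms by (auto simp: I_top_def)

text \<open>The choice of a domain, a codomain and a function disappears here. What remains is
  symmetric in \<open>u\<close> and its converse, so inverses and composites of partial
  homeomorphisms reduce to relation algebra.\<close>

lemma I_top_iff:
  "u \<in> I_top A B \<longleftrightarrow>
     single_valued u \<and> single_valued (u\<inverse>) \<and> u \<subseteq> topspace A \<times> topspace B \<and>
     (\<forall>U. openin A U \<longrightarrow> openin B (u `` U)) \<and> (\<forall>V. openin B V \<longrightarrow> openin A (u\<inverse> `` V))"
  (is "_ \<longleftrightarrow> ?R")
proof
  assume "u \<in> I_top A B"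
  then obtain U V f where u: "u = fun_graph U f" and UV: "openin A U" "openin B V"
    and f: "homeomorphic_map (subtopology A U) (subtopology B V) f"
    by (auto simp: I_top_def)
  have sub: "U \<subseteq> topspace A" "V \<subseteq> topspace B"
    using UV openin_subset by auto
  then have tops: "topspace (subtopology A U) = U" "topspace (subtopology B V) = V"
    by auto
  have f': "inj_on f U" "f ` U = V" "continuous_map (subtopology A U) (subtopology B V) f"
      "open_map (subtopology A U) (subtopology B V) f"
    using f unfolding homeomorphic_eq_everything_map tops by blast+
  have "openin B (u `` W)" if "openin A W" for W
  proof -
    have "openin (subtopology A U) (U \<inter> W)"
      using that UV by (simp add: openin_open_subtopology openin_Int)
    then have "openin (subtopology B V) (f ` (U \<inter> W))"
      using f'(4) by (simp add: open_map_def)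
    then show ?thesis
      using UV by (simp add: u Image_fun_graph openin_open_subtopology)
  qed
  moreover have "openin A (u\<inverse> `` W)" if "openin B W" for W
  proof -
    have "openin (subtopology B V) (V \<inter> W)"
      using that UV by (simp add: openin_open_subtopology openin_Int)
    then have "openin (subtopology A U) {x \<in> U. f x \<in> V \<inter> W}"
      using f'(3) unfolding continuous_map_def tops by blast
    moreover have "{x \<in> U. f x \<in> V \<inter> W} = {x \<in> U. f x \<in> W}"
      using f'(2) by auto
    ultimately show ?thesis
      using UV by (simp add: u converse_Image_fun_graph openin_open_subtopology)
  qed
  ultimately show ?R
    using f'(1,2) sub by (auto simp: u fun_graph_def single_valued_def inj_on_def)
next
  assume R: ?R
  \<comment> \<open>The domain and the range of \<open>u\<close> are open, being the preimage and
    the image of the whole spaces.\<close>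
  define U where "U = u\<inverse> `` topspace B"
  define V where "V = u `` topspace A"
  define f where "f x = (THE y. (x, y) \<in> u)" for x
  have UV: "openin A U" "openin B V"
    using R by (auto simp: U_def V_def)
  have sub: "U \<subseteq> topspace A" "V \<subseteq> topspace B"
    using UV openin_subset by auto
  have f: "f x = y" if "(x, y) \<in> u" for x y
    using that R by (auto simp: f_def single_valued_def)
  have u: "u = fun_graph U f"
    using R f by (fastforce simp: fun_graph_def U_def)
  have im: "f ` U = V"
    using R f by (fastforce simp: U_def V_def)
  have "homeomorphic_map (subtopology A U) (subtopology B V) f"
  proof (rule bijective_open_imp_homeomorphic_map)
    show "continuous_map (subtopology A U) (subtopology B V) f"
      unfolding continuous_map_def
    proof (intro conjI allI impI)
      show "f \<in> topspace (subtopology A U) \<rightarrow> topspace (subtopology B V)"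
        using im sub by auto
      fix W assume "openin (subtopology B V) W"
      then have "openin A (u\<inverse> `` W)"
        using R UV by (simp add: openin_open_subtopology)
      then show "openin (subtopology A U) {x \<in> topspace (subtopology A U). f x \<in> W}"
        using UV sub by (auto simp: u converse_Image_fun_graph openin_open_subtopology Int_absorb1)
    qed
    show "open_map (subtopology A U) (subtopology B V) f"
      unfolding open_map_def
    proof (intro allI impI)
      fix W assume "openin (subtopology A U) W"
      then have "openin B (u `` W)" "W \<subseteq> U"
        using R UV by (simp_all add: openin_open_subtopology)
      moreover have "u `` W = f ` W"
        using \<open>W \<subseteq> U\<close> by (auto simp: u Image_fun_graph)
      ultimately show "openin (subtopology B V) (f ` W)"
        using UV im by (auto simp: openin_open_subtopology)
    qed
    show "f ` topspace (subtopology A U) = topspace (subtopology B V)"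
      using im sub by (simp add: Int_absorb1)
    show "inj_on f (topspace (subtopology A U))"
    proof (rule inj_onI)
      fix x y assume "x \<in> topspace (subtopology A U)" "y \<in> topspace (subtopology A U)" "f x = f y"
      then have "(x, f x) \<in> u" "(y, f x) \<in> u"
        by (auto simp: u fun_graph_def)
      then show "x = y"
        using R by (auto simp: single_valued_def)
    qed
  qed
  then show "u \<in> I_top A B"
    unfolding u using fun_graph_in_I_top UV by blast
qed

lemma I_topD:
  assumes "u \<in> I_top A B"
  shows "single_valued u" "single_valued (u\<inverse>)" "u \<subseteq> topspace A \<times> topspace B"
    "\<And>U. openin A U \<Longrightarrow> openin B (u `` U)" "\<And>V. openin B V \<Longrightarrow> openin A (u\<inverse> `` V)"
  using assms by (simp_all add: I_top_iff)

lemma I_top_converse: "u \<in> I_top A B \<Longrightarrow> u\<inverse> \<in> I_top B A"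
  by (auto simp: I_top_iff)

lemma I_top_relcomp:
  assumes u: "u \<in> I_top A B" and v: "v \<in> I_top B C"
  shows "u O v \<in> I_top A C"
proof -
  have "single_valued (u O v)" "single_valued ((u O v)\<inverse>)"
    using I_topD(1,2)[OF u] I_topD(1,2)[OF v]
    by (simp_all add: single_valued_relcomp converse_relcomp)
  moreover have "u O v \<subseteq> topspace A \<times> topspace C"
    using I_topD(3)[OF u] I_topD(3)[OF v] by blast
  ultimately show ?thesis
    unfolding I_top_iff converse_relcomp relcomp_Image
    using I_topD(4,5)[OF u] I_topD(4,5)[OF v] by blast
qed

lemma empty_in_I_top: "{} \<in> I_top A B"
  by (simp add: I_top_iff)

lemma Id_on_in_I_top:
  assumes "openin A U" shows "Id_on U \<in> I_top A A"
proof -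
  have "Id_on U `` W = U \<inter> W" for W by auto
  then show ?thesis
    using assms openin_subset[OF assms]
    by (auto simp: I_top_iff single_valued_def openin_Int)
qed

text \<open>A graph determines its domain and the values of the function there. So the witnesses
  hidden in \<open>I_top\<close> agree with \<open>U\<close> and with \<open>f\<close> on
  \<open>U\<close>, and the open target is forced to be the image.\<close>

lemma homeomorphic_map_if_fun_graph_in_I_top:
  assumes "fun_graph U f \<in> I_top A B"
  shows "homeomorphic_map (subtopology A U) (subtopology B (f ` U)) f"
proof -
  obtain U' V f' where eq: "fun_graph U f = fun_graph U' f'" and UV: "openin A U'" "openin B V"
    and f': "homeomorphic_map (subtopology A U') (subtopology B V) f'"
    using assms by (auto simp: I_top_def)
  have "U' = U"
    using arg_cong[OF eq, of Domain] by (simp add: fun_graph_def Domain_fst image_image)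
  moreover have "f x = f' x" if "x \<in> U" for x
  proof -
    have "(x, f x) \<in> fun_graph U f" using that by (auto simp: fun_graph_def)
    then have "(x, f x) \<in> fun_graph U' f'" by (simp only: eq)
    then show ?thesis by (auto simp: fun_graph_def)
  qed
  moreover from f' have "f' ` topspace (subtopology A U') = topspace (subtopology B V)"
    by (rule homeomorphic_imp_surjective_map)
  then have "f' ` U' = V"
    using UV openin_subset by (metis topspace_subtopology_subset)
  ultimately show ?thesis
    using homeomorphic_map_eq[OF f', of f] by auto
qed

lemma fun_graph_in_I_top_subtopology:
  assumes "fun_graph U f \<in> I_top A B"
  shows "fun_graph U f \<in> I_top (subtopology A U) (subtopology B (f ` U))"
proof (rule fun_graph_in_I_top)
  have "U \<subseteq> topspace A" "f ` U \<subseteq> topspace B"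
    using I_topD(3)[OF assms] by (auto simp: fun_graph_def)
  then show "openin (subtopology A U) U" "openin (subtopology B (f ` U)) (f ` U)"
    by (simp_all add: openin_subtopology_refl)
  show "homeomorphic_map (subtopology (subtopology A U) U)
      (subtopology (subtopology B (f ` U)) (f ` U)) f"
    using homeomorphic_map_if_fun_graph_in_I_top[OF assms] by (simp add: subtopology_subtopology)
qed

section \<open>Gluing structures\<close>

text \<open>The family of all members of \<open>P\<close> contained in \<open>u\<close> is the
  largest candidate for \<open>T\<close>. This turns membership in \<open>pg_hat\<close> and in
  \<open>I_S\<close> into a condition that is checked near one pair at a time.\<close>

lemma union_of_subset_iff: "(\<exists>T\<subseteq>P. u = \<Union>T) \<longleftrightarrow> (\<forall>p\<in>u. \<exists>s\<in>P. p \<in> s \<and> s \<subseteq> u)"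
proof
  assume "\<forall>p\<in>u. \<exists>s\<in>P. p \<in> s \<and> s \<subseteq> u"
  then have "u = \<Union>{s \<in> P. s \<subseteq> u}" by blast
  moreover have "{s \<in> P. s \<subseteq> u} \<subseteq> P" by blast
  ultimately show "\<exists>T\<subseteq>P. u = \<Union>T" by metis
qed blast

lemma pg_hat_iff:
  "v \<in> pg_hat A S \<longleftrightarrow> v \<in> I_top A A \<and> (\<forall>p\<in>v. \<exists>s\<in>S. p \<in> s \<and> s \<subseteq> v)"
  by (simp add: pg_hat_def union_of_subset_iff)

lemma I_S_iff:
  "u \<in> I_S X H Y K \<longleftrightarrow>
     u \<in> I_top X Y \<and> (\<forall>p\<in>u. \<exists>f\<in>H. \<exists>g\<in>K. p \<in> f O g\<inverse> \<and> f O g\<inverse> \<subseteq> u)"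
  unfolding I_S_def union_of_subset_iff by (simp add: Bex_def) metis

lemma pg_hatE:
  assumes "v \<in> pg_hat A S" "p \<in> v"
  obtains s where "s \<in> S" "p \<in> s" "s \<subseteq> v"
  using assms unfolding pg_hat_iff by blast

lemma I_SE:
  assumes "u \<in> I_S X H Y K" "p \<in> u"
  obtains f g where "f \<in> H" "g \<in> K" "p \<in> f O g\<inverse>" "f O g\<inverse> \<subseteq> u"
  using assms unfolding I_S_iff by metis

lemma pg_hat_I_top: "v \<in> pg_hat A S \<Longrightarrow> v \<in> I_top A A"
  by (simp add: pg_hat_iff)

text \<open>Locality of the completed pseudogroup: a union of unions is a union. Later proofs use it
  to replace a relation by a smaller one, around a given pair, that factors through suitable
  charts.\<close>

lemma pg_hat_local:
  assumes "v \<in> I_top A A" and "\<And>p. p \<in> v \<Longrightarrow> \<exists>w\<in>pg_hat A S. p \<in> w \<and> w \<subseteq> v"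
  shows "v \<in> pg_hat A S"
  unfolding pg_hat_iff
proof (intro conjI ballI assms(1))
  fix p assume "p \<in> v"
  then obtain w where w: "w \<in> pg_hat A S" "p \<in> w" "w \<subseteq> v" using assms(2) by blast
  obtain s where "s \<in> S" "p \<in> s" "s \<subseteq> w" using pg_hatE[OF w(1,2)] .
  then show "\<exists>s\<in>S. p \<in> s \<and> s \<subseteq> v" using w(3) by blast
qed

section \<open>Inverses and composites in the completed pseudogroup, and maps read in charts\<close>

lemma pseudogroup_subset_pg_hat: "pseudogroup A S \<Longrightarrow> S \<subseteq> pg_hat A S"
  unfolding pseudogroup_def by (blast intro: pg_hat_iff[THEN iffD2])

lemma pg_hat_converse:
  assumes S: "pseudogroup A S" and u: "u \<in> pg_hat A S"
  shows "u\<inverse> \<in> pg_hat A S"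
  unfolding pg_hat_iff
proof (intro conjI ballI)
  show "u\<inverse> \<in> I_top A A"
    using u by (simp add: I_top_converse pg_hat_I_top)
  fix p assume "p \<in> u\<inverse>"
  then obtain a b where p: "p = (b, a)" "(a, b) \<in> u" by blast
  then obtain s where "s \<in> S" "(a, b) \<in> s" "s \<subseteq> u"
    using pg_hatE[OF u] by metis
  then have "s\<inverse> \<in> S" "p \<in> s\<inverse>" "s\<inverse> \<subseteq> u\<inverse>"
    using S p unfolding pseudogroup_def by blast+
  then show "\<exists>s\<in>S. p \<in> s \<and> s \<subseteq> u\<inverse>" by metis
qed

lemma pg_hat_relcomp:
  assumes S: "pseudogroup A S" and u: "u \<in> pg_hat A S" and v: "v \<in> pg_hat A S"
  shows "u O v \<in> pg_hat A S"
  unfolding pg_hat_iff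
proof (intro conjI ballI)
  show "u O v \<in> I_top A A"
    using u v by (blast intro: I_top_relcomp pg_hat_I_top)
  fix p assume "p \<in> u O v"
  then obtain a b c where p: "p = (a, c)" "(a, b) \<in> u" "(b, c) \<in> v" by blast
  obtain s where "s \<in> S" "(a, b) \<in> s" "s \<subseteq> u"
    using pg_hatE[OF u p(2)] .
  moreover obtain t where "t \<in> S" "(b, c) \<in> t" "t \<subseteq> v" using pg_hatE[OF v p(3)] .
  ultimately have "s O t \<in> S" "p \<in> s O t" "s O t \<subseteq> u O v"
    using S p unfolding pseudogroup_def by blast+
  then show "\<exists>s\<in>S. p \<in> s \<and> s \<subseteq> u O v" by metis
qed

lemma S_atlasD:
  assumes "S_atlas A S X H"
  shows "\<And>f. f \<in> H \<Longrightarrow> f \<in> I_top X A"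
    "\<And>x. x \<in> topspace X \<Longrightarrow> \<exists>f\<in>H. \<exists>a. (x, a) \<in> f"
    "\<And>f g. f \<in> H \<Longrightarrow> g \<in> H \<Longrightarrow> f\<inverse> O g \<in> pg_hat A S"
  using assms unfolding S_atlas_def by blast+

text \<open>Around each pair, \<open>u\<close> contains a composite \<open>f' O g'\<inverse>\<close>
  of charts. Read between \<open>f\<close> and \<open>g\<close>, this composite splits into the two
  transition maps \<open>f\<inverse> O f'\<close> and \<open>g'\<inverse> O g\<close>, which the
  atlas conditions put in \<open>pg_hat\<close>.\<close>

lemma I_S_in_charts:
  assumes S: "pseudogroup A S" and H: "S_atlas A S X H" and K: "S_atlas A S Y K"
    and u: "u \<in> I_S X H Y K" and f: "f \<in> H" and g: "g \<in> K"
  shows "f\<inverse> O u O g \<in> pg_hat A S"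
proof (rule pg_hat_local)
  have "u \<in> I_top X Y" using u by (simp add: I_S_iff)
  then show "f\<inverse> O u O g \<in> I_top A A"
    using S_atlasD(1)[OF H f] S_atlasD(1)[OF K g] by (blast intro: I_top_relcomp I_top_converse)
  fix p assume "p \<in> f\<inverse> O u O g"
  then obtain a x y b where p: "p = (a, b)" "(x, a) \<in> f" "(x, y) \<in> u" "(y, b) \<in> g" by blast
  obtain f' g' where fg: "f' \<in> H" "g' \<in> K" "(x, y) \<in> f' O g'\<inverse>" "f' O g'\<inverse> \<subseteq> u"
    using I_SE[OF u p(3)] .
  let ?w = "(f\<inverse> O f') O (g'\<inverse> O g)"
  have "?w \<in> pg_hat A S"
    using S_atlasD(3)[OF H f fg(1)] S_atlasD(3)[OF K fg(2) g] S by (simp add: pg_hat_relcomp)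
  moreover have "p \<in> ?w" using p fg(3) by blast
  moreover have "?w \<subseteq> f\<inverse> O u O g" using fg(4) by blast
  ultimately show "\<exists>w\<in>pg_hat A S. p \<in> w \<and> w \<subseteq> f\<inverse> O u O g" by metis
qed

lemma S_structure_restrict_chart:
  assumes S: "pseudogroup A S" and H: "S_structure A S X H"
    and U: "openin X U" and f: "f \<in> H"
  shows "Id_on U O f \<in> H"
proof -
  have fI: "f \<in> I_top X A"
    using H f S_atlasD(1) unfolding S_structure_def by blast
  define F where "F = {f O Id_on V | V. Id_on V \<in> S \<and> f O Id_on V \<subseteq> Id_on U O f}"
  have "Id_on U O f \<subseteq> \<Union>F"
  proof
    fix p assume "p \<in> Id_on U O f"
    then obtain x a where p: "p = (x, a)" "x \<in> U" "(x, a) \<in> f" by blast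
    have "openin A (f `` U)" using I_topD(4)[OF fI U] .
    then have "(arbitrary union_of (\<lambda>V. Id_on V \<in> S)) (f `` U)"
      using S by (simp add: pseudogroup_def)
    then obtain V where V: "Id_on V \<in> S" "a \<in> V" "V \<subseteq> f `` U"
      using p by (auto simp: arbitrary_union_of_alt)
    have "f O Id_on V \<subseteq> Id_on U O f"
    proof
      fix q assume "q \<in> f O Id_on V"
      then obtain y b where q: "q = (y, b)" "(y, b) \<in> f" "b \<in> V" by blast
      then obtain z where "z \<in> U" "(z, b) \<in> f" using V(3) by blast
      then have "y \<in> U" using q I_topD(2)[OF fI] by (auto simp: single_valued_def)
      then show "q \<in> Id_on U O f" using q by blast
    qed
    then show "p \<in> \<Union>F" using V p unfolding F_def by blast
  qed
  then have "\<Union>F = Id_on U O f" unfolding F_def by blast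
  moreover have "Id_on U O f \<in> I_top X A"
    using I_top_relcomp[OF Id_on_in_I_top[OF U] fI] .
  moreover have "F \<subseteq> H" using H f unfolding F_def S_structure_def by blast
  moreover have "\<And>F. F \<subseteq> H \<Longrightarrow> \<Union>F \<in> I_top X A \<Longrightarrow> \<Union>F \<in> H"
    using H unfolding S_structure_def by blast
  ultimately show ?thesis by metis
qed

text \<open>The charts of \<open>X\<close> are transported to \<open>X'\<close> along the partial homeomorphisms \<open>j \<in> J\<close>.\<close>

definition glued_structure ::
  "'a topology \<Rightarrow> ('a \<times> 'a) set set \<Rightarrow> ('x \<times> 'a) set set \<Rightarrow> 'y topology \<Rightarrow> ('x \<times> 'y) set set \<Rightarrow>
   ('y \<times> 'a) set set" where
  "glued_structure A S H X' J = {f \<in> I_top X' A. \<forall>j\<in>J. \<forall>h\<in>H. h\<inverse> O j O f \<in> pg_hat A S}"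

text \<open>The chart \<open>h\<close> read through \<open>j\<close> is compatible with every other
  \<open>k\<close> and \<open>h'\<close>, because the comparison contains the change of coordinates
  \<open>k O j\<inverse>\<close>, which is \<open>S\<close>-preserving and hence in
  \<open>pg_hat\<close> when read in charts.\<close>

lemma glued_structure_chart:
  assumes S: "pseudogroup A S" and H: "S_atlas A S X H"
    and J: "J \<subseteq> I_top X X'"
    and trans: "\<And>j k. j \<in> J \<Longrightarrow> k \<in> J \<Longrightarrow> j O k\<inverse> \<in> I_S X H X H"
    and j: "j \<in> J" and h: "h \<in> H"
  shows "j\<inverse> O h \<in> glued_structure A S H X' J"
  unfolding glued_structure_def
proof (intro CollectI conjI ballI)
  show "j\<inverse> O h \<in> I_top X' A"
    using J j S_atlasD(1)[OF H h] by (blast intro: I_top_relcomp I_top_converse)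
  fix k h' assume "k \<in> J" "h' \<in> H"
  then have "h'\<inverse> O (k O j\<inverse>) O h \<in> pg_hat A S"
    using I_S_in_charts[OF S H H trans] j h by blast
  then show "h'\<inverse> O k O j\<inverse> O h \<in> pg_hat A S" by (simp add: O_assoc)
qed

text \<open>Since the atlas consists of all maps compatible with the transported charts,
  completeness follows from closure of \<open>pg_hat\<close> under composition and from its
  locality. Two compatible charts are compared with each other through a transported chart around
  the point.\<close>

lemma S_structure_glued:
  assumes S: "pseudogroup A S" and H: "S_atlas A S X H"
    and J: "J \<subseteq> I_top X X'" and cover: "topspace X' \<subseteq> (\<Union>j\<in>J. Range j)"
    and trans: "\<And>j k. j \<in> J \<Longrightarrow> k \<in> J \<Longrightarrow> j O k\<inverse> \<in> I_S X H X H"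
  shows "S_structure A S X' (glued_structure A S H X' J)" (is "S_structure A S X' ?H'")
proof -
  have cov: "\<exists>j\<in>J. \<exists>h\<in>H. \<exists>x a. (x, p) \<in> j \<and> (x, a) \<in> h" if "p \<in> topspace X'" for p
  proof -
    have "p \<in> (\<Union>j\<in>J. Range j)" using cover that by (rule subsetD)
    then obtain j x where "j \<in> J" "(x, p) \<in> j" by blast
    moreover then have "x \<in> topspace X" using J I_topD(3)[of j X X'] by blast
    ultimately show ?thesis using S_atlasD(2)[OF H] by meson
  qed
  have "S_atlas A S X' ?H'"
    unfolding S_atlas_def
  proof (intro conjI ballI)
    show "?H' \<subseteq> I_top X' A" by (auto simp: glued_structure_def)
    show "{} \<in> ?H'" by (simp add: glued_structure_def pg_hat_iff empty_in_I_top)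
    have dom: "Domain f \<subseteq> topspace X'" if "f \<in> ?H'" for f
      using that I_topD(3)[of f X' A] unfolding glued_structure_def by blast
    then have "p \<in> topspace X'" if "p \<in> (\<Union>f\<in>?H'. Domain f)" for p
      using that by (meson UN_E subsetD)
    moreover have "p \<in> (\<Union>f\<in>?H'. Domain f)" if p: "p \<in> topspace X'" for p
    proof -
      obtain j h x a where *: "j \<in> J" "h \<in> H" "(x, p) \<in> j" "(x, a) \<in> h"
        using cov[OF p] by blast
      then have "j\<inverse> O h \<in> ?H'" using glued_structure_chart[OF S H J trans] by simp
      then show ?thesis using * by blast
    qed
    ultimately show "(\<Union>f\<in>?H'. Domain f) = topspace X'" by (intro equalityI subsetI)
    fix f g assume f: "f \<in> ?H'" and g: "g \<in> ?H'"
    show "f\<inverse> O g \<in> pg_hat A S"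
    proof (rule pg_hat_local)
      show "f\<inverse> O g \<in> I_top A A"
        using f g unfolding glued_structure_def by (blast intro: I_top_relcomp I_top_converse)
      fix q assume "q \<in> f\<inverse> O g"
      then obtain a p b where q: "q = (a, b)" "(p, a) \<in> f" "(p, b) \<in> g" by blast
      then have "p \<in> topspace X'"
        using f dom by blast
      then obtain j h x c where *: "j \<in> J" "h \<in> H" "(x, p) \<in> j" "(x, c) \<in> h"
        using cov by metis
      \<comment> \<open>A detour from \<open>f\<close> to \<open>g\<close> through \<open>j\<close>
        and \<open>h\<close>: the first factor is the converse of the compatibility map of
        \<open>f\<close>, the second is that of \<open>g\<close>.\<close>
      let ?w = "(f\<inverse> O (j\<inverse> O h)) O (h\<inverse> O j O g)"
      have gl: "h\<inverse> O j O f \<in> pg_hat A S" "h\<inverse> O j O g \<in> pg_hat A S"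
        using f g * unfolding glued_structure_def by simp_all
      have "(h\<inverse> O j O f)\<inverse> = f\<inverse> O (j\<inverse> O h)"
        by (simp add: converse_relcomp O_assoc)
      then have "?w \<in> pg_hat A S"
        using gl pg_hat_relcomp[OF S pg_hat_converse[OF S]] by metis
      moreover have "q \<in> ?w" using q * by blast
      moreover have "?w \<subseteq> f\<inverse> O g"
      proof -
        \<comment> \<open>Going to \<open>h\<close> and back returns to the same point of
          \<open>X\<close> as \<open>h\<close> is injective, and \<open>j\<close> then leads back to
          the same point of \<open>X'\<close>.\<close>
        have "single_valued (h\<inverse>)" "single_valued j"
          using I_topD(2)[OF S_atlasD(1)[OF H *(2)]] I_topD(1)[of j X X'] * J by blast+
        then show ?thesis unfolding single_valued_def by blast
      qed
      ultimately show "\<exists>w\<in>pg_hat A S. q \<in> w \<and> w \<subseteq> f\<inverse> O g" by metis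
    qed
  qed
  moreover have "f O u \<in> ?H'" if f: "f \<in> ?H'" and u: "u \<in> S" for f u
    unfolding glued_structure_def
  proof (intro CollectI conjI ballI)
    have u': "u \<in> pg_hat A S" using pseudogroup_subset_pg_hat[OF S] u by blast
    show "f O u \<in> I_top X' A"
      using f u' unfolding glued_structure_def by (blast intro: I_top_relcomp pg_hat_I_top)
    fix j h assume "j \<in> J" "h \<in> H"
    then have "(h\<inverse> O j O f) O u \<in> pg_hat A S"
      using f u' S by (simp add: glued_structure_def pg_hat_relcomp)
    then show "h\<inverse> O j O f O u \<in> pg_hat A S" by (simp add: O_assoc)
  qed
  moreover have "\<Union>F \<in> ?H'" if F: "F \<subseteq> ?H'" and UF: "\<Union>F \<in> I_top X' A" for F
    unfolding glued_structure_def
  proof (intro CollectI conjI ballI UF)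
    fix j h assume jh: "j \<in> J" "h \<in> H"
    show "h\<inverse> O j O \<Union>F \<in> pg_hat A S"
    proof (rule pg_hat_local)
      show "h\<inverse> O j O \<Union>F \<in> I_top A A"
        using jh J S_atlasD(1)[OF H jh(2)] UF by (blast intro: I_top_relcomp I_top_converse)
      fix p assume "p \<in> h\<inverse> O j O \<Union>F"
      then obtain f where f: "f \<in> F" "p \<in> h\<inverse> O j O f" by blast
      moreover have "h\<inverse> O j O f \<in> pg_hat A S"
        using F f jh by (auto simp: glued_structure_def)
      moreover have "h\<inverse> O j O f \<subseteq> h\<inverse> O j O \<Union>F" using f by blast
      ultimately show "\<exists>w\<in>pg_hat A S. p \<in> w \<and> w \<subseteq> h\<inverse> O j O \<Union>F" by metis
    qed
  qed
  ultimately show ?thesis by (simp add: S_structure_def)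
qed

text \<open>Each local factor \<open>f O g\<inverse>\<close> of \<open>u\<close> is cut down on the
  side of \<open>f\<close>, where restriction to an open set yields a chart again.\<close>

lemma I_S_restrict:
  assumes S: "pseudogroup A S" and H: "S_structure A S X H"
    and U: "openin X U" and u: "u \<in> I_S X H Y K"
  shows "Id_on U O u \<in> I_S X H Y K"
  unfolding I_S_iff
proof (intro conjI ballI)
  show "Id_on U O u \<in> I_top X Y"
    using u I_top_relcomp[OF Id_on_in_I_top[OF U]] unfolding I_S_iff by metis
  fix p assume "p \<in> Id_on U O u"
  then have p: "p \<in> u" "fst p \<in> U" by auto
  obtain f g where fg: "f \<in> H" "g \<in> K" "p \<in> f O g\<inverse>" "f O g\<inverse> \<subseteq> u"
    using I_SE[OF u p(1)] .
  have "Id_on U O f \<in> H" using S_structure_restrict_chart[OF S H U fg(1)] .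
  moreover have "p \<in> (Id_on U O f) O g\<inverse>"
  proof -
    have "p \<in> Id_on U O (f O g\<inverse>)"
      using p(2) fg(3) by (cases p) (simp add: relcomp.relcompI[OF Id_onI])
    then show ?thesis by (simp only: O_assoc)
  qed
  moreover have "(Id_on U O f) O g\<inverse> \<subseteq> Id_on U O u"
    using relcomp_mono[OF subset_refl fg(4)] by (simp add: O_assoc)
  ultimately show "\<exists>f\<in>H. \<exists>g\<in>K. p \<in> f O g\<inverse> \<and> f O g\<inverse> \<subseteq> Id_on U O u"
    using fg(2) by metis
qed

section \<open>Orbits\<close>

text \<open>This is B. H. Neumann's lemma for two subgroups: if a group is a finite union of cosets of
  the stabilizers of \<open>p\<close> and \<open>q\<close>, then one of these has finite index.\<close>

lemma (in group_action) finite_orbit_if_translates_meet_finite: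
  assumes p: "p \<in> E" and q: "q \<in> E" and F: "finite F"
    and cover: "\<And>g. g \<in> carrier G \<Longrightarrow> \<phi> g p \<in> F \<or> \<phi> g q \<in> F"
  shows "finite (orbit G \<phi> p) \<or> finite (orbit G \<phi> q)"
proof (rule disjCI)
  interpret group G using group_hom group_hom.axioms(1) by auto
  assume "infinite (orbit G \<phi> q)"
  then have "\<not> orbit G \<phi> q \<subseteq> F" using F finite_subset by blast
  then obtain g\<^sub>0 where g\<^sub>0: "g\<^sub>0 \<in> carrier G" "\<phi> g\<^sub>0 q \<notin> F" by (auto simp: orbit_def)
  \<comment> \<open>\<open>B f\<close> collects the positions of \<open>p\<close> while
    \<open>q\<close> sits at \<open>f\<close>. When \<open>q\<close> is in \<open>F\<close> the
    point \<open>p\<close> lies in one of these sets, and otherwise it lies in \<open>F\<close>; so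
    it suffices that each \<open>B f\<close> is finite.\<close>
  define B where "B f = {\<phi> g p | g. g \<in> carrier G \<and> \<phi> g q = f}" for f
  have "finite (B f)" for f
  proof (cases "\<exists>h\<in>carrier G. \<phi> h q = f")
    case True
    then obtain h where h: "h \<in> carrier G" "\<phi> h q = f" by blast
    have "\<phi> g p \<in> \<phi> (h \<otimes> inv g\<^sub>0) ` F" if g: "g \<in> carrier G" "\<phi> g q = f" for g
    proof -
      \<comment> \<open>As \<open>g\<close> and \<open>h\<close> both send \<open>q\<close> to
        \<open>f\<close>, the element \<open>s\<close> sends \<open>q\<close> to
        \<open>\<phi> g\<^sub>0 q\<close>, outside \<open>F\<close>. Hence \<open>s\<close> sends
        \<open>p\<close> into \<open>F\<close>, and applying
        \<open>h \<otimes> inv g\<^sub>0\<close> recovers \<open>\<phi> g p\<close> in a translate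
        of \<open>F\<close> that depends only on \<open>f\<close>.\<close>
      define s where "s = (g\<^sub>0 \<otimes> inv h) \<otimes> g"
      have s: "s \<in> carrier G" using g h g\<^sub>0 by (simp add: s_def)
      have "\<phi> s q = \<phi> (g\<^sub>0 \<otimes> inv h) (\<phi> h q)"
        using g h g\<^sub>0 q by (simp add: s_def composition_rule)
      also have "\<dots> = \<phi> g\<^sub>0 q"
      proof -
        have "\<phi> (g\<^sub>0 \<otimes> inv h) (\<phi> h q) = \<phi> (g\<^sub>0 \<otimes> inv h \<otimes> h) q"
          by (rule composition_rule[symmetric]) (use h g\<^sub>0 q in simp_all)
        then show ?thesis using h g\<^sub>0 by (simp add: m_assoc)
      qed
      finally have "\<phi> s p \<in> F" using cover[OF s] g\<^sub>0 by simp
      moreover have "(h \<otimes> inv g\<^sub>0) \<otimes> s = g"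
      proof -
        have "(h \<otimes> inv g\<^sub>0) \<otimes> s = h \<otimes> (inv g\<^sub>0 \<otimes> (g\<^sub>0 \<otimes> (inv h \<otimes> g)))"
          using g h g\<^sub>0 by (simp add: s_def m_assoc)
        then show ?thesis using g h g\<^sub>0 by (simp add: inv_solve_left m_assoc[symmetric])
      qed
      moreover have "\<phi> (h \<otimes> inv g\<^sub>0) (\<phi> s p) = \<phi> ((h \<otimes> inv g\<^sub>0) \<otimes> s) p"
        using composition_rule[OF p _ s] h g\<^sub>0 by simp
      ultimately show ?thesis by (metis imageI)
    qed
    then have "B f \<subseteq> \<phi> (h \<otimes> inv g\<^sub>0) ` F" unfolding B_def by blast
    then show ?thesis using F finite_surj by blast
  next
    case False
    then have "B f = {}" unfolding B_def by blast
    then show ?thesis by simp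
  qed
  then have "finite (F \<union> (\<Union>f\<in>F. B f))" using F by blast
  moreover have "orbit G \<phi> p \<subseteq> F \<union> (\<Union>f\<in>F. B f)"
    using cover unfolding orbit_def B_def by blast
  ultimately show "finite (orbit G \<phi> p)" using finite_subset by blast
qed

section \<open>Points of the globalization\<close>

locale partial_action = group G for G :: "('g, 'm) monoid_scheme" (structure) +
  fixes X :: "'x topology" and \<alpha> :: "'g \<Rightarrow> ('x \<times> 'x) set"
  assumes partial_action: "topological_partial_action G X \<alpha>"
begin

text \<open>The point \<open>[(g, x)]\<close> of the globalization, that is, the translate by
  \<open>g\<close> of the embedded point \<open>x\<close>.\<close>

definition cls :: "'g \<Rightarrow> 'x \<Rightarrow> ('g \<times> 'x) set" where
  "cls g x = glob_rel G X \<alpha> `` {(g, x)}"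

lemma act_I_top: "g \<in> carrier G \<Longrightarrow> \<alpha> g \<in> I_top X X"
  using partial_action by (simp add: topological_partial_action_def)

lemma act_topspace: "g \<in> carrier G \<Longrightarrow> (x, y) \<in> \<alpha> g \<Longrightarrow> x \<in> topspace X \<and> y \<in> topspace X"
  using I_topD(3)[OF act_I_top] by blast

lemma act_one: "(x, y) \<in> \<alpha> \<one> \<longleftrightarrow> x \<in> topspace X \<and> x = y"
  using partial_action by (auto simp: topological_partial_action_def)

lemma act_inv: "g \<in> carrier G \<Longrightarrow> (x, y) \<in> \<alpha> (inv g) \<longleftrightarrow> (y, x) \<in> \<alpha> g"
  using partial_action by (simp add: topological_partial_action_def)

lemma act_mult:
  "g \<in> carrier G \<Longrightarrow> h \<in> carrier G \<Longrightarrow> (x, y) \<in> \<alpha> h \<Longrightarrow> (y, z) \<in> \<alpha> g \<Longrightarrow> (x, z) \<in> \<alpha> (g \<otimes> h)"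
  using partial_action unfolding topological_partial_action_def by blast

lemma glob_rel_iff:
  "((h, x), (k, y)) \<in> glob_rel G X \<alpha> \<longleftrightarrow>
     h \<in> carrier G \<and> k \<in> carrier G \<and> (x, y) \<in> \<alpha> (inv k \<otimes> h)"
  using act_topspace[of "inv k \<otimes> h" x y] by (auto simp: glob_rel_def)

text \<open>Each property mirrors one axiom of a partial action: reflexivity the unit, symmetry the
  inverse, transitivity the inclusion of composites.\<close>

lemma equiv_glob_rel: "equiv (carrier G \<times> topspace X) (glob_rel G X \<alpha>)"
proof (rule equivI)
  show "glob_rel G X \<alpha> \<subseteq> (carrier G \<times> topspace X) \<times> carrier G \<times> topspace X"
    by (auto simp: glob_rel_def)
  show "refl_on (carrier G \<times> topspace X) (glob_rel G X \<alpha>)"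
    by (auto simp: refl_on_def glob_rel_iff act_one)
  have "((k, y), (h, x)) \<in> glob_rel G X \<alpha>" if "((h, x), (k, y)) \<in> glob_rel G X \<alpha>" for h x k y
    using that act_inv[of "inv k \<otimes> h" y x] by (auto simp: glob_rel_iff inv_mult_group)
  then show "sym (glob_rel G X \<alpha>)" by (auto simp: sym_def)
  have "((h, x), (l, z)) \<in> glob_rel G X \<alpha>"
    if "((h, x), (k, y)) \<in> glob_rel G X \<alpha>" "((k, y), (l, z)) \<in> glob_rel G X \<alpha>" for h x k y l z
  proof -
    have *: "h \<in> carrier G" "k \<in> carrier G" "l \<in> carrier G"
      "(x, y) \<in> \<alpha> (inv k \<otimes> h)" "(y, z) \<in> \<alpha> (inv l \<otimes> k)"
      using that by (auto simp: glob_rel_iff)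
    have "inv l \<otimes> k \<otimes> (inv k \<otimes> h) = inv l \<otimes> (k \<otimes> inv k) \<otimes> h"
      using * by (simp only: m_assoc inv_closed m_closed)
    then show ?thesis
      using * act_mult[OF _ _ *(4,5)] by (simp add: glob_rel_iff)
  qed
  then show "trans (glob_rel G X \<alpha>)" by (auto intro!: transI)
qed

lemma cls_eq_iff:
  assumes "g \<in> carrier G" "k \<in> carrier G" "x \<in> topspace X" "y \<in> topspace X"
  shows "cls g x = cls k y \<longleftrightarrow> (x, y) \<in> \<alpha> (inv k \<otimes> g)"
  using assms eq_equiv_class_iff[OF equiv_glob_rel, of "(g, x)" "(k, y)"]
  by (simp add: cls_def glob_rel_iff)

lemma cls_inject:
  "\<lbrakk>g \<in> carrier G; x \<in> topspace X; y \<in> topspace X\<rbrakk> \<Longrightarrow> cls g x = cls g y \<longleftrightarrow> x = y"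
  by (simp add: cls_eq_iff act_one)

lemma globalization_eq: "globalization G X \<alpha> = {cls g x | g x. g \<in> carrier G \<and> x \<in> topspace X}"
  by (auto simp: globalization_def quotient_def cls_def)

lemma glob_embed_eq: "glob_embed G X \<alpha> = cls \<one>"
  by (simp add: fun_eq_iff glob_embed_def cls_def)

text \<open>The relation sees two group coordinates only through \<open>inv k \<otimes> g\<close>,
  which left translation by \<open>h\<close> leaves unchanged. Translation by \<open>inv h\<close>
  shows that the image is a whole class.\<close>

lemma glob_act_cls:
  assumes h: "h \<in> carrier G" and g: "g \<in> carrier G"
  shows "glob_act G h (cls g x) = cls (h \<otimes> g) x"
proof -
  have cls: "(k, y) \<in> cls l x \<longleftrightarrow> k \<in> carrier G \<and> (x, y) \<in> \<alpha> (inv k \<otimes> l)"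
    if "l \<in> carrier G" for k y l
    using that by (simp add: cls_def glob_rel_iff)
  have eq: "inv (h \<otimes> k) \<otimes> (h \<otimes> g) = inv k \<otimes> g" if "k \<in> carrier G" for k
  proof -
    have "inv (h \<otimes> k) \<otimes> (h \<otimes> g) = inv k \<otimes> (inv h \<otimes> h) \<otimes> g"
      using that h g by (simp only: inv_mult_group m_assoc inv_closed m_closed)
    then show ?thesis using that h g by simp
  qed
  show ?thesis
  proof (intro equalityI subsetI)
    fix p assume "p \<in> glob_act G h (cls g x)"
    then obtain k y where "p = (h \<otimes> k, y)" "(k, y) \<in> cls g x"
      by (auto simp: glob_act_def)
    then show "p \<in> cls (h \<otimes> g) x" using h g by (simp add: cls eq)
  next
    fix p assume p: "p \<in> cls (h \<otimes> g) x"
    obtain k y where ky: "p = (k, y)" by (cases p)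
    then have k: "k \<in> carrier G" using p h g by (simp add: cls)
    have hk: "h \<otimes> (inv h \<otimes> k) = k" using h k by (simp add: m_assoc[symmetric])
    have "(inv h \<otimes> k, y) \<in> cls g x"
      using p h g k ky eq[of "inv h \<otimes> k"] by (simp add: cls hk)
    then show "p \<in> glob_act G h (cls g x)"
      unfolding glob_act_def using ky hk by (intro image_eqI[of _ _ "(inv h \<otimes> k, y)"]) simp_all
  qed
qed

lemma glob_act_one: "C \<in> globalization G X \<alpha> \<Longrightarrow> glob_act G \<one> C = C"
  by (auto simp: globalization_eq glob_act_cls)

lemma glob_act_mult:
  "\<lbrakk>g \<in> carrier G; h \<in> carrier G; C \<in> globalization G X \<alpha>\<rbrakk> \<Longrightarrow>
     glob_act G (g \<otimes> h) C = glob_act G g (glob_act G h C)"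
  by (auto simp: globalization_eq glob_act_cls m_assoc)

text \<open>Translation by \<open>inv g\<close> is the inverse bijection. The maps are restricted
  because \<open>Bij\<close> asks for extensional functions.\<close>

lemma group_action_invariant_subset:
  assumes Z: "Z \<subseteq> globalization G X \<alpha>"
    and inv: "\<And>g C. g \<in> carrier G \<Longrightarrow> C \<in> Z \<Longrightarrow> glob_act G g C \<in> Z"
  shows "group_action G Z (\<lambda>g. restrict (glob_act G g) Z)"
proof -
  have inverse: "glob_act G (inv g) (glob_act G g C) = C" "glob_act G g (glob_act G (inv g) C) = C"
    if "g \<in> carrier G" "C \<in> Z" for g C
    using that Z glob_act_one[of C] glob_act_mult[of "inv g" g C] glob_act_mult[of g "inv g" C]
    by auto
  have Bij: "restrict (glob_act G g) Z \<in> Bij Z" if g: "g \<in> carrier G" for g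
  proof -
    have "bij_betw (glob_act G g) Z Z"
      by (rule bij_betw_byWitness[where f' = "glob_act G (inv g)"]) (use g inv inverse in auto)
    then show ?thesis by (simp add: Bij_def)
  qed
  have "restrict (glob_act G (g \<otimes> h)) Z =
      compose Z (restrict (glob_act G g) Z) (restrict (glob_act G h) Z)"
    if "g \<in> carrier G" "h \<in> carrier G" for g h
    using that Z inv by (auto simp: fun_eq_iff compose_def restrict_def glob_act_mult subset_iff)
  then have "(\<lambda>g. restrict (glob_act G g) Z) \<in> hom G (BijGroup Z)"
    using Bij by (auto simp: hom_def BijGroup_def)
  then show ?thesis
    by (intro group_action.intro group_hom.intro group_hom_axioms.intro group_BijGroup is_group)
qed

end

section \<open>Invariant subsets of the globalization\<close>

text \<open>Here \<open>Z\<close> is the invariant set left after the removal of the finite orbits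
  that are not contained in \<open>X\<close>; the last assumption records this removal.\<close>

locale separated_globalization = partial_action G X \<alpha>
  for G :: "('g, 'm) monoid_scheme" (structure) and X :: "'x topology"
    and \<alpha> :: "'g \<Rightarrow> ('x \<times> 'x) set" +
  fixes A :: "'a topology" and S :: "('a \<times> 'a) set set" and H :: "('x \<times> 'a) set set"
    and Z :: "('g \<times> 'x) set set"
  assumes S: "pseudogroup A S" and H: "S_structure A S X H" and Hausdorff: "Hausdorff_space X"
    and preserving: "S_preserving G X H \<alpha>"
    and Z: "Z \<subseteq> globalization G X \<alpha>"
    and invariant: "\<And>g C. g \<in> carrier G \<Longrightarrow> C \<in> Z \<Longrightarrow> glob_act G g C \<in> Z"
    and finite_X_minus_Z: "finite (cls \<one> ` topspace X - Z)"
    and finite_Z_minus_X: "finite (Z - cls \<one> ` topspace X)"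
    and finite_orbit: "\<And>C. \<lbrakk>C \<in> Z; finite (orbit G (\<lambda>g. restrict (glob_act G g) Z) C)\<rbrakk> \<Longrightarrow>
      orbit G (\<lambda>g. restrict (glob_act G g) Z) C \<subseteq> cls \<one> ` topspace X"
begin

text \<open>The part of \<open>X\<close> that lies in \<open>Z\<close>. It serves as the cofinite
  subset \<open>Y\<close> and also as the common source of all the coordinate maps
  \<open>cls g\<close> into \<open>Z\<close>.\<close>

definition D :: "'x set" where
  "D = {x \<in> topspace X. cls \<one> x \<in> Z}"

definition zact :: "'g \<Rightarrow> ('g \<times> 'x) set \<Rightarrow> ('g \<times> 'x) set" where
  "zact = (\<lambda>g. restrict (glob_act G g) Z)"

text \<open>The final topology on \<open>Z\<close> for the maps \<open>cls g\<close> on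
  \<open>D\<close>, with \<open>g\<close> ranging over the group.\<close>

definition Ztop :: "('g \<times> 'x) set topology" where
  "Ztop = topology (\<lambda>U. U \<subseteq> Z \<and> (\<forall>g\<in>carrier G. openin X {x \<in> D. cls g x \<in> U}))"

definition inj_graph :: "'g \<Rightarrow> ('x \<times> ('g \<times> 'x) set) set" where
  "inj_graph g = fun_graph D (cls g)"

definition ZH :: "(('g \<times> 'x) set \<times> 'a) set set" where
  "ZH = glued_structure A S H Ztop (inj_graph ` carrier G)"

lemma H_atlas: "S_atlas A S X H"
  using H by (simp add: S_structure_def)

section \<open>Coordinates on the invariant set\<close>

lemma zact_action: "group_action G Z zact"
  unfolding zact_def using group_action_invariant_subset[OF Z invariant] .

lemma D_subset: "D \<subseteq> topspace X"
  by (auto simp: D_def)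

text \<open>The classes \<open>cls g x\<close> and \<open>cls \<one> x\<close> are translates of
  each other by \<open>g\<close> and \<open>inv g\<close>, and \<open>Z\<close> is invariant under
  both.\<close>

lemma cls_in_Z: "g \<in> carrier G \<Longrightarrow> x \<in> topspace X \<Longrightarrow> cls g x \<in> Z \<longleftrightarrow> x \<in> D"
  using invariant[of g "cls \<one> x"] invariant[of "inv g" "cls g x"]
  by (auto simp: D_def glob_act_cls)

lemma cls_D_in_Z: "g \<in> carrier G \<Longrightarrow> x \<in> D \<Longrightarrow> cls g x \<in> Z"
  using cls_in_Z D_subset by blast

lemma Z_cases:
  assumes "C \<in> Z"
  obtains g x where "g \<in> carrier G" "x \<in> D" "C = cls g x"
proof -
  obtain g x where "g \<in> carrier G" "x \<in> topspace X" "C = cls g x"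
    using assms Z unfolding globalization_eq by blast
  then show ?thesis using that assms cls_in_Z by simp
qed

lemma Z_inter_X: "Z \<inter> cls \<one> ` topspace X = cls \<one> ` D"
  by (auto simp: D_def)

lemma cls_eq_iff_D:
  "\<lbrakk>g \<in> carrier G; k \<in> carrier G; x \<in> D; y \<in> D\<rbrakk> \<Longrightarrow>
     cls g x = cls k y \<longleftrightarrow> (x, y) \<in> \<alpha> (inv k \<otimes> g)"
  using cls_eq_iff D_subset by blast

lemma cls_inject_D: "\<lbrakk>g \<in> carrier G; x \<in> D; y \<in> D\<rbrakk> \<Longrightarrow> cls g x = cls g y \<longleftrightarrow> x = y"
  using cls_inject D_subset by blast

lemma zact_cls: "\<lbrakk>g \<in> carrier G; k \<in> carrier G; x \<in> D\<rbrakk> \<Longrightarrow> zact g (cls k x) = cls (g \<otimes> k) x"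
  using cls_D_in_Z by (simp add: zact_def glob_act_cls)

lemma finite_X_minus_D: "finite (topspace X - D)"
proof -
  have "cls \<one> ` (topspace X - D) \<subseteq> cls \<one> ` topspace X - Z"
    by (auto simp: D_def)
  then have "finite (cls \<one> ` (topspace X - D))"
    using finite_X_minus_Z finite_subset by blast
  moreover have "inj_on (cls \<one>) (topspace X - D)"
    by (auto simp: inj_on_def cls_inject)
  ultimately show ?thesis using finite_imageD by blast
qed

lemma openin_D: "openin X D"
proof -
  have "closedin X (topspace X - D)"
    using Hausdorff finite_X_minus_D by (simp add: closedin_Hausdorff_finite)
  then show ?thesis using D_subset by (simp add: openin_closedin_eq)
qed

section \<open>The glued topology and the glued structure\<close>

lemma openin_Ztop: "openin Ztop U \<longleftrightarrow> U \<subseteq> Z \<and> (\<forall>g\<in>carrier G. openin X {x \<in> D. cls g x \<in> U})"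
proof -
  have "istopology (\<lambda>U. U \<subseteq> Z \<and> (\<forall>g\<in>carrier G. openin X {x \<in> D. cls g x \<in> U}))"
    unfolding istopology_def
  proof (intro conjI allI impI ballI)
    fix U V g
    assume "U \<subseteq> Z \<and> (\<forall>g\<in>carrier G. openin X {x \<in> D. cls g x \<in> U})"
      "V \<subseteq> Z \<and> (\<forall>g\<in>carrier G. openin X {x \<in> D. cls g x \<in> V})" and g: "g \<in> carrier G"
    then have "openin X ({x \<in> D. cls g x \<in> U} \<inter> {x \<in> D. cls g x \<in> V})"
      by (intro openin_Int) simp_all
    moreover have "{x \<in> D. cls g x \<in> U} \<inter> {x \<in> D. cls g x \<in> V} = {x \<in> D. cls g x \<in> U \<inter> V}"
      by blast
    ultimately show "openin X {x \<in> D. cls g x \<in> U \<inter> V}" by simp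
  next
    fix K g
    assume K: "\<forall>U\<in>K. U \<subseteq> Z \<and> (\<forall>g\<in>carrier G. openin X {x \<in> D. cls g x \<in> U})"
      and g: "g \<in> carrier G"
    then have "openin X (\<Union>U\<in>K. {x \<in> D. cls g x \<in> U})"
      by (intro openin_Union) auto
    moreover have "(\<Union>U\<in>K. {x \<in> D. cls g x \<in> U}) = {x \<in> D. cls g x \<in> \<Union>K}"
      by blast
    ultimately show "openin X {x \<in> D. cls g x \<in> \<Union>K}" by simp
  qed auto
  then show ?thesis by (simp add: Ztop_def topology_inverse')
qed

lemma topspace_Ztop: "topspace Ztop = Z"
proof -
  have "{x \<in> D. cls g x \<in> Z} = D" if "g \<in> carrier G" for g
    using that cls_D_in_Z by blast
  then have "openin Ztop Z" using openin_D by (simp add: openin_Ztop)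
  then show ?thesis
    using openin_subset openin_topspace by (metis openin_Ztop subset_antisym)
qed

lemma inj_graph_iff: "(x, C) \<in> inj_graph g \<longleftrightarrow> x \<in> D \<and> C = cls g x"
  by (auto simp: inj_graph_def fun_graph_def)

text \<open>The point is that images of open sets are open: in the coordinate \<open>cls k\<close>,
  the image of \<open>U\<close> under \<open>cls g\<close> becomes a preimage under the partial
  homeomorphism \<open>\<alpha> (inv g \<otimes> k)\<close>, cut down to the open set
  \<open>D\<close>.\<close>

lemma inj_graph_I_top:
  assumes g: "g \<in> carrier G"
  shows "inj_graph g \<in> I_top X Ztop"
  unfolding I_top_iff
proof (intro conjI allI impI)
  show "single_valued (inj_graph g)" "single_valued ((inj_graph g)\<inverse>)"
    using g by (auto simp: single_valued_def inj_graph_iff cls_inject_D)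
  show "inj_graph g \<subseteq> topspace X \<times> topspace Ztop"
    using g D_subset by (auto simp: inj_graph_iff topspace_Ztop cls_D_in_Z)
  fix U assume U: "openin X U"
  show "openin Ztop (inj_graph g `` U)"
    unfolding openin_Ztop
  proof (intro conjI ballI)
    show "inj_graph g `` U \<subseteq> Z"
      using g by (auto simp: inj_graph_iff cls_D_in_Z)
    fix k assume k: "k \<in> carrier G"
    have "{x \<in> D. cls k x \<in> inj_graph g `` U} = D \<inter> (\<alpha> (inv g \<otimes> k))\<inverse> `` (U \<inter> D)"
      using g k cls_eq_iff_D[OF k g] by (fastforce simp: inj_graph_iff)
    then show "openin X {x \<in> D. cls k x \<in> inj_graph g `` U}"
      using I_topD(5)[OF act_I_top] g k U openin_D by (simp add: openin_Int)
  qed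
next
  fix V assume "openin Ztop V"
  moreover have "(inj_graph g)\<inverse> `` V = {x \<in> D. cls g x \<in> V}"
    by (auto simp: inj_graph_iff)
  ultimately show "openin X ((inj_graph g)\<inverse> `` V)"
    using g by (simp add: openin_Ztop)
qed

text \<open>By the criterion for equality of classes, the change of coordinates is
  \<open>\<alpha> (inv k \<otimes> g)\<close> with source cut down to \<open>D\<close>. The target
  needs no cut: a point of \<open>D\<close> and its image represent the same class, which lies in
  \<open>Z\<close>.\<close>

lemma inj_graph_transition:
  assumes g: "g \<in> carrier G" and k: "k \<in> carrier G"
  shows "inj_graph g O (inj_graph k)\<inverse> \<in> I_S X H X H"
proof -
  have "y \<in> D" if "x \<in> D" "(x, y) \<in> \<alpha> (inv k \<otimes> g)" for x y
  proof -
    have xy: "x \<in> topspace X" "y \<in> topspace X"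
      using act_topspace[of "inv k \<otimes> g" x y] that g k by auto
    then have "cls g x = cls k y" using that g k by (simp add: cls_eq_iff)
    then show ?thesis using cls_in_Z[OF g xy(1)] cls_in_Z[OF k xy(2)] that by simp
  qed
  then have "inj_graph g O (inj_graph k)\<inverse> = Id_on D O \<alpha> (inv k \<otimes> g)"
    using cls_eq_iff_D[OF g k] by (fastforce simp: inj_graph_iff)
  moreover have "\<alpha> (inv k \<otimes> g) \<in> I_S X H X H"
    using preserving g k by (simp add: S_preserving_def)
  ultimately show ?thesis
    using I_S_restrict[OF S H openin_D] by simp
qed

lemma inj_graph_chart:
  assumes "g \<in> carrier G" "h \<in> H"
  shows "(inj_graph g)\<inverse> O h \<in> ZH"
  unfolding ZH_def
  by (rule glued_structure_chart[OF S H_atlas])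
    (use assms inj_graph_I_top inj_graph_transition in auto)

lemma S_structure_ZH: "S_structure A S Ztop ZH"
  unfolding ZH_def
proof (rule S_structure_glued[OF S H_atlas])
  show "topspace Ztop \<subseteq> (\<Union>j\<in>inj_graph ` carrier G. Range j)"
  proof
    fix C assume "C \<in> topspace Ztop"
    then obtain g x where "g \<in> carrier G" "(x, C) \<in> inj_graph g"
      using Z_cases by (metis topspace_Ztop inj_graph_iff)
    then show "C \<in> (\<Union>j\<in>inj_graph ` carrier G. Range j)" by blast
  qed
qed (use inj_graph_I_top inj_graph_transition in auto)

section \<open>Separation of points\<close>

lemma common_translate_in_X:
  assumes p: "p \<in> Z" and q: "q \<in> Z"
  shows "\<exists>g\<in>carrier G. zact g p \<in> cls \<one> ` topspace X \<and> zact g q \<in> cls \<one> ` topspace X"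
proof (rule ccontr)
  interpret group_action G Z zact by (rule zact_action)
  let ?E = "cls \<one> ` topspace X"
  assume no: "\<not> ?thesis"
  have "zact g p \<in> Z \<and> zact g q \<in> Z" if "g \<in> carrier G" for g
    using element_image[OF that] p q by blast
  then have cover: "zact g p \<in> Z - ?E \<or> zact g q \<in> Z - ?E" if "g \<in> carrier G" for g
    using no that by blast
  \<comment> \<open>Neumann's lemma does not tell which of the two orbits is finite, so the
    contradiction is derived for a pair \<open>r\<close>, \<open>s\<close> that is used in both
    orders.\<close>
  have one_sided: False
    if "r \<in> Z" "s \<in> Z" "finite (orbit G zact r)"
      and cov: "\<And>g. g \<in> carrier G \<Longrightarrow> zact g r \<in> Z - ?E \<or> zact g s \<in> Z - ?E" for r s
  proof -
    have "orbit G zact r \<subseteq> ?E"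
      using finite_orbit that unfolding zact_def by blast
    then have s: "orbit G zact s \<subseteq> Z - ?E"
      using cov unfolding orbit_def by blast
    then have "finite (orbit G zact s)"
      using finite_Z_minus_X finite_subset by blast
    then have "orbit G zact s \<subseteq> ?E"
      using finite_orbit \<open>s \<in> Z\<close> unfolding zact_def by blast
    then show False using s orbit_refl[OF \<open>s \<in> Z\<close>] by blast
  qed
  show False
    using finite_orbit_if_translates_meet_finite[OF p q finite_Z_minus_X cover]
      one_sided[OF p q] one_sided[OF q p] cover by blast
qed

text \<open>An element \<open>g\<close> that moves both points into \<open>X\<close> shows that both
  lie in the image of the single coordinate map \<open>cls (inv g)\<close>. This map is injective
  and open, so it carries disjoint neighborhoods in \<open>X\<close> to disjoint neighborhoods in
  \<open>Z\<close>.\<close>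

lemma Hausdorff_Ztop: "Hausdorff_space Ztop"
  unfolding Hausdorff_space_def topspace_Ztop
proof (intro allI impI)
  interpret group_action G Z zact by (rule zact_action)
  fix p q assume pq: "p \<in> Z \<and> q \<in> Z \<and> p \<noteq> q"
  then obtain g where g: "g \<in> carrier G" "zact g p \<in> cls \<one> ` topspace X"
      "zact g q \<in> cls \<one> ` topspace X"
    using common_translate_in_X by blast
  have chart: "\<exists>x\<in>D. r = cls (inv g) x" if r: "r \<in> Z" "zact g r \<in> cls \<one> ` topspace X" for r
  proof -
    have "zact g r \<in> Z" using element_image[OF g(1) r(1)] by blast
    then have "zact g r \<in> cls \<one> ` D" using r(2) Z_inter_X by blast
    then obtain x where x: "x \<in> D" "zact g r = cls \<one> x" by blast
    have "zact (inv g) (cls \<one> x) = r"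
      using orbit_sym_aux[OF g(1) r(1) x(2)] .
    then show ?thesis using x g by (auto simp: zact_cls)
  qed
  obtain x y where xy: "x \<in> D" "y \<in> D" "p = cls (inv g) x" "q = cls (inv g) y"
    using chart pq g by blast
  then have "x \<in> topspace X" "y \<in> topspace X" "x \<noteq> y"
    using pq D_subset by auto
  then obtain U V where UV: "openin X U" "openin X V" "x \<in> U" "y \<in> V" "disjnt U V"
    using Hausdorff unfolding Hausdorff_space_def by metis
  let ?j = "inj_graph (inv g)"
  have j: "?j \<in> I_top X Ztop" using inj_graph_I_top g by simp
  show "\<exists>U V. openin Ztop U \<and> openin Ztop V \<and> p \<in> U \<and> q \<in> V \<and> disjnt U V"
  proof (intro exI conjI)
    show "openin Ztop (?j `` U)" "openin Ztop (?j `` V)"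
      using I_topD(4)[OF j] UV by simp_all
    show "p \<in> ?j `` U" "q \<in> ?j `` V"
      using UV xy by (auto simp: inj_graph_iff)
    show "disjnt (?j `` U) (?j `` V)"
      using UV(5) g cls_inject_D[of "inv g"] by (auto simp: disjnt_iff inj_graph_iff)
  qed
qed

section \<open>The action on the glued space\<close>

lemma continuous_map_zact:
  assumes g: "g \<in> carrier G"
  shows "continuous_map Ztop Ztop (zact g)"
  unfolding continuous_map_def
proof (intro conjI allI impI)
  interpret group_action G Z zact by (rule zact_action)
  show "zact g \<in> topspace Ztop \<rightarrow> topspace Ztop"
    using element_image[OF g] by (auto simp: topspace_Ztop)
  fix U assume U: "openin Ztop U"
  \<comment> \<open>The action permutes the maps that define the topology: composing
    \<open>cls k\<close> with \<open>zact g\<close> gives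
    \<open>cls (g \<otimes> k)\<close>.\<close>
  have "{x \<in> D. cls k x \<in> {C \<in> Z. zact g C \<in> U}} = {x \<in> D. cls (g \<otimes> k) x \<in> U}"
    if "k \<in> carrier G" for k
    using that g by (auto simp: cls_D_in_Z zact_cls)
  then show "openin Ztop {C \<in> topspace Ztop. zact g C \<in> U}"
    using U g by (simp add: openin_Ztop topspace_Ztop)
qed

lemma homeomorphic_map_zact:
  assumes g: "g \<in> carrier G"
  shows "homeomorphic_map Ztop Ztop (zact g)"
proof -
  interpret group_action G Z zact by (rule zact_action)
  have "zact (inv g) (zact g C) = C" "zact g (zact (inv g) C) = C" if "C \<in> Z" for C
    using orbit_sym_aux[OF g that refl] orbit_sym_aux[OF inv_closed[OF g] that refl] g by simp_all
  then have "homeomorphic_maps Ztop Ztop (zact g) (zact (inv g))"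
    using continuous_map_zact g by (simp add: homeomorphic_maps_def topspace_Ztop)
  then show ?thesis using homeomorphic_map_maps by blast
qed

lemma S_preserving_zact: "S_preserving G Ztop ZH (action_graph Ztop zact)"
  unfolding S_preserving_def
proof
  fix g assume g: "g \<in> carrier G"
  have gr: "action_graph Ztop zact g = fun_graph Z (zact g)"
    by (simp add: action_graph_def topspace_Ztop)
  show "action_graph Ztop zact g \<in> I_S Ztop ZH Ztop ZH"
    unfolding I_S_iff
  proof (intro conjI ballI)
    have "subtopology Ztop Z = Ztop"
      using subtopology_topspace[of Ztop] by (simp add: topspace_Ztop)
    moreover have "openin Ztop Z"
      using openin_topspace[of Ztop] by (simp add: topspace_Ztop)
    ultimately show "action_graph Ztop zact g \<in> I_top Ztop Ztop"
      unfolding gr using fun_graph_in_I_top[of Ztop Z Ztop Z] homeomorphic_map_zact[OF g] by simp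
    fix p assume "p \<in> action_graph Ztop zact g"
    then obtain C where C: "C \<in> Z" "p = (C, zact g C)"
      by (auto simp: gr fun_graph_def)
    obtain k x where k: "k \<in> carrier G" "x \<in> D" "C = cls k x" using Z_cases[OF C(1)] .
    obtain h a where h: "h \<in> H" "(x, a) \<in> h"
      using S_atlasD(2)[OF H_atlas] k(2) D_subset by blast
    have sv: "single_valued (h\<inverse>)" using I_topD(2)[OF S_atlasD(1)[OF H_atlas h(1)]] .
    \<comment> \<open>Both charts come from the same \<open>h\<close>, transported by
      \<open>cls k\<close> and by \<open>cls (g \<otimes> k)\<close>. In these charts
      \<open>zact g\<close> is an identity map, by injectivity of \<open>h\<close>.\<close>
    let ?f = "(inj_graph k)\<inverse> O h" and ?f' = "(inj_graph (g \<otimes> k))\<inverse> O h"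
    have "?f \<in> ZH" "?f' \<in> ZH" using inj_graph_chart h(1) g k(1) by simp_all
    moreover have "p \<in> ?f O ?f'\<inverse>"
    proof -
      have "(C, a) \<in> ?f" "(cls (g \<otimes> k) x, a) \<in> ?f'"
        using h(2) k by (auto simp: inj_graph_iff)
      moreover have "p = (C, cls (g \<otimes> k) x)" using C k g by (simp add: zact_cls)
      ultimately show ?thesis by blast
    qed
    moreover have "?f O ?f'\<inverse> \<subseteq> action_graph Ztop zact g"
    proof
      fix q assume "q \<in> ?f O ?f'\<inverse>"
      then obtain c b y z where q: "q = (cls k y, cls (g \<otimes> k) z)" "y \<in> D" "(y, b) \<in> h" "(z, b) \<in> h"
        by (auto simp: inj_graph_iff)
      then have "z = y" using sv by (auto simp: single_valued_def)
      then show "q \<in> action_graph Ztop zact g"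
        using q g k by (auto simp: gr fun_graph_def zact_cls cls_D_in_Z)
    qed
    ultimately show "\<exists>f\<in>ZH. \<exists>f'\<in>ZH. p \<in> f O f'\<inverse> \<and> f O f'\<inverse> \<subseteq> action_graph Ztop zact g"
      by metis
  qed
qed

lemma continuous_action_zact: "continuous_action G Ztop zact"
  using zact_action continuous_map_zact by (simp add: continuous_action_def topspace_Ztop)

section \<open>Comparison with the original space\<close>

lemma modeled_iso_cls:
  "modeled_iso (subtopology X D) (restrict_structure H D)
     (subtopology Ztop (cls \<one> ` D)) (restrict_structure ZH (cls \<one> ` D)) (cls \<one>)"
proof -
  have graph: "fun_graph D (cls \<one>) \<in> I_top X Ztop"
    using inj_graph_I_top[OF one_closed] by (simp add: inj_graph_def)
  have "fun_graph D (cls \<one>) \<in>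
    I_S (subtopology X D) (restrict_structure H D)
      (subtopology Ztop (cls \<one> ` D)) (restrict_structure ZH (cls \<one> ` D))"
    unfolding I_S_iff
  proof (intro conjI ballI fun_graph_in_I_top_subtopology[OF graph])
    fix p assume "p \<in> fun_graph D (cls \<one>)"
    then obtain x where x: "x \<in> D" "p = (x, cls \<one> x)" by (auto simp: fun_graph_def)
    obtain h a where h: "h \<in> H" "(x, a) \<in> h"
      using S_atlasD(2)[OF H_atlas] x(1) D_subset by blast
    have sv: "single_valued (h\<inverse>)" using I_topD(2)[OF S_atlasD(1)[OF H_atlas h(1)]] .
    let ?f = "Id_on D O h" and ?f' = "(inj_graph \<one>)\<inverse> O h"
    have "?f \<in> restrict_structure H D"
      using S_structure_restrict_chart[OF S H openin_D h(1)] by (auto simp: restrict_structure_def)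
    moreover have "?f' \<in> restrict_structure ZH (cls \<one> ` D)"
      using inj_graph_chart[OF one_closed h(1)] by (auto simp: restrict_structure_def inj_graph_iff)
    moreover have "p \<in> ?f O ?f'\<inverse>"
    proof -
      have "(x, a) \<in> ?f" "(cls \<one> x, a) \<in> ?f'"
        using h(2) x by (auto simp: inj_graph_iff)
      then show ?thesis using x(2) by blast
    qed
    moreover have "?f O ?f'\<inverse> \<subseteq> fun_graph D (cls \<one>)"
    proof
      fix q assume "q \<in> ?f O ?f'\<inverse>"
      then obtain b y z where q: "q = (y, cls \<one> z)" "y \<in> D" "(y, b) \<in> h" "(z, b) \<in> h"
        by (auto simp: inj_graph_iff)
      then have "z = y" using sv by (auto simp: single_valued_def)
      then show "q \<in> fun_graph D (cls \<one>)" using q by (auto simp: fun_graph_def)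
    qed
    ultimately show "\<exists>f\<in>restrict_structure H D. \<exists>f'\<in>restrict_structure ZH (cls \<one> ` D).
        p \<in> f O f'\<inverse> \<and> f O f'\<inverse> \<subseteq> fun_graph D (cls \<one>)"
      by metis
  qed
  then show ?thesis
    using homeomorphic_map_if_fun_graph_in_I_top[OF graph] D_subset
    by (simp add: modeled_iso_def Int_absorb1)
qed

text \<open>Since \<open>zact g\<close> sends \<open>cls \<one> x\<close> to \<open>cls g x\<close>,
  the criterion for equality of classes says that it reaches \<open>cls \<one> y\<close> exactly
  when \<open>(x, y) \<in> \<alpha> g\<close>.\<close>

lemma biequivariant_cls:
  "biequivariant G (restrict_partial_action \<alpha> D)
     (restrict_partial_action (action_graph Ztop zact) (cls \<one> ` D)) (cls \<one>)"
  unfolding biequivariant_def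
proof
  fix g assume g: "g \<in> carrier G"
  have eq: "zact g (cls \<one> x) = cls \<one> y \<longleftrightarrow> (x, y) \<in> \<alpha> g" if "x \<in> D" "y \<in> D" for x y
    using cls_eq_iff_D[OF g one_closed that] g that by (simp add: zact_cls)
  have "(C, C') \<in> restrict_partial_action (action_graph Ztop zact) (cls \<one> ` D) g \<longleftrightarrow>
      C \<in> cls \<one> ` D \<and> C' \<in> cls \<one> ` D \<and> zact g C = C'" for C C'
    using cls_D_in_Z[OF one_closed]
    by (auto simp: restrict_partial_action_def action_graph_def fun_graph_def topspace_Ztop)
  then show "map_prod (cls \<one>) (cls \<one>) ` restrict_partial_action \<alpha> D g =
      restrict_partial_action (action_graph Ztop zact) (cls \<one> ` D) g"
    using eq by (fastforce simp: restrict_partial_action_def)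
qed

lemma cofinite_biequivariant_iso_cls:
  "cofinite_biequivariant_iso G X H \<alpha> Ztop ZH (action_graph Ztop zact) D (cls \<one> ` D) (cls \<one>)"
proof -
  have "Z - cls \<one> ` D = Z - cls \<one> ` topspace X" using Z_inter_X by blast
  then show ?thesis
    using D_subset finite_X_minus_D cls_D_in_Z[OF one_closed] finite_Z_minus_X
      modeled_iso_cls biequivariant_cls
    by (auto simp: cofinite_biequivariant_iso_def topspace_Ztop)
qed

lemma finite_orbit_subset:
  assumes "C \<in> Z" "finite (orbit G zact C)"
  shows "orbit G zact C \<subseteq> cls \<one> ` D"
proof -
  interpret group_action G Z zact by (rule zact_action)
  have "orbit G zact C \<subseteq> Z"
    using assms(1) element_image by (auto simp: orbit_def)
  moreover have "orbit G zact C \<subseteq> cls \<one> ` topspace X"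
    using finite_orbit assms by (simp add: zact_def)
  ultimately show ?thesis using Z_inter_X by blast
qed

end

section \<open>Removal of finite orbits and conclusion\<close>

theorem theorem6p7:
  fixes A :: "'a topology" and S :: "('a \<times> 'a) set set"
    and X :: "'x topology" and H :: "('x \<times> 'a) set set"
    and G :: "('g, 'm) monoid_scheme" and \<alpha> :: "'g \<Rightarrow> ('x \<times> 'x) set"
  assumes "pseudogroup A S"
    and "S_structure A S X H" and "Hausdorff_space X"
    and "group G"
    and "topological_partial_action G X \<alpha>" and "S_preserving G X H \<alpha>"
    and "transfixes G X \<alpha>"
  shows "\<exists>(X' :: ('g \<times> 'x) set topology) H' \<phi> Y Y' \<psi>.
           Hausdorff_space X' \<and> S_structure A S X' H' \<and>
           continuous_action G X' \<phi> \<and> S_preserving G X' H' (action_graph X' \<phi>) \<and>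
           cofinite_biequivariant_iso G X H \<alpha> X' H' (action_graph X' \<phi>) Y Y' \<psi> \<and>
           (\<forall>x\<in>topspace X'. finite (orbit G \<phi> x) \<longrightarrow> orbit G \<phi> x \<subseteq> Y')"
proof -
  interpret partial_action G X \<alpha>
    using assms(4,5) by (simp add: partial_action_def partial_action_axioms_def)
  let ?E = "cls \<one>\<^bsub>G\<^esub> ` topspace X"
  obtain X0 where X0: "X0 \<subseteq> globalization G X \<alpha>"
    and inv0: "\<And>g C. g \<in> carrier G \<Longrightarrow> C \<in> X0 \<Longrightarrow> glob_act G g C \<in> X0"
    and fin0: "finite (sym_diff ?E X0)"
    using assms(7) unfolding transfixes_def glob_embed_eq by blast
  define \<phi>0 where "\<phi>0 g = restrict (glob_act G g) X0" for g
  interpret act0: group_action G X0 \<phi>0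
    unfolding \<phi>0_def using group_action_invariant_subset[OF X0 inv0] .
  define Z where "Z = {C \<in> X0. finite (orbit G \<phi>0 C) \<longrightarrow> orbit G \<phi>0 C \<subseteq> ?E}"
  have ZX0: "Z \<subseteq> X0" by (auto simp: Z_def)
  have orbit_subset: "orbit G \<phi>0 C \<subseteq> X0" if "C \<in> X0" for C
    using that act0.element_image by (auto simp: orbit_def)
  \<comment> \<open>The condition defining \<open>Z\<close> depends only on the orbit of a point,
    which makes \<open>Z\<close> invariant.\<close>
  have orbit_eq: "orbit G \<phi>0 C' = orbit G \<phi>0 C" if "C \<in> X0" "C' \<in> orbit G \<phi>0 C" for C C'
  proof -
    have C': "C' \<in> X0" using that orbit_subset by blast
    then have C: "C \<in> orbit G \<phi>0 C'" using act0.orbit_sym that by blast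
    show ?thesis
    proof (intro equalityI subsetI)
      fix c assume "c \<in> orbit G \<phi>0 C'"
      then show "c \<in> orbit G \<phi>0 C"
        using act0.orbit_trans[OF that(1) C' _ that(2)] orbit_subset[OF C'] by blast
    next
      fix c assume "c \<in> orbit G \<phi>0 C"
      then show "c \<in> orbit G \<phi>0 C'"
        using act0.orbit_trans[OF C' that(1) _ C] orbit_subset[OF that(1)] by blast
    qed
  qed
  have inv: "glob_act G g C \<in> Z" if "g \<in> carrier G" "C \<in> Z" for g C
  proof -
    have C: "C \<in> X0" using that ZX0 by blast
    then have "glob_act G g C = \<phi>0 g C" by (simp add: \<phi>0_def)
    then have "glob_act G g C \<in> orbit G \<phi>0 C" using that by (auto simp: orbit_def)
    then show ?thesis using that orbit_eq[OF C] inv0 by (simp add: Z_def)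
  qed
  \<comment> \<open>Passing from \<open>X0\<close> to \<open>Z\<close> does not change the maps at
    points of \<open>Z\<close>, so orbits computed in either set agree there.\<close>
  have orbit_Z: "orbit G (\<lambda>g. restrict (glob_act G g) Z) C = orbit G \<phi>0 C" if "C \<in> Z" for C
    using that ZX0 by (auto simp: orbit_def \<phi>0_def)
  \<comment> \<open>A removed point has a finite orbit that meets the finite set
    \<open>X0 - ?E\<close>, so finitely many finite orbits contain all removed points.\<close>
  have "X0 - Z \<subseteq> (\<Union>C\<in>{C \<in> X0 - ?E. finite (orbit G \<phi>0 C)}. orbit G \<phi>0 C)"
  proof
    fix C assume "C \<in> X0 - Z"
    then obtain C' where C: "C \<in> X0" "finite (orbit G \<phi>0 C)" "C' \<in> orbit G \<phi>0 C" "C' \<notin> ?E"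
      by (auto simp: Z_def)
    then have "C' \<in> X0 - ?E" "orbit G \<phi>0 C' = orbit G \<phi>0 C"
      using orbit_subset orbit_eq by blast+
    then show "C \<in> (\<Union>C\<in>{C \<in> X0 - ?E. finite (orbit G \<phi>0 C)}. orbit G \<phi>0 C)"
      using C act0.orbit_refl by auto
  qed
  moreover have "finite {C \<in> X0 - ?E. finite (orbit G \<phi>0 C)}"
    using fin0 finite_subset[of "{C \<in> X0 - ?E. finite (orbit G \<phi>0 C)}" "X0 - ?E"] by auto
  then have "finite (\<Union>C\<in>{C \<in> X0 - ?E. finite (orbit G \<phi>0 C)}. orbit G \<phi>0 C)"
    by (rule finite_UN_I) simp
  ultimately have "finite (X0 - Z)" by (rule finite_subset)
  moreover have "?E - Z \<subseteq> (?E - X0) \<union> (X0 - Z)" by blast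
  moreover have "finite (?E - X0)" using fin0 by simp
  ultimately have "finite (?E - Z)" by (meson finite_Un finite_subset)
  moreover have "finite (Z - ?E)" using fin0 ZX0 finite_subset[of "Z - ?E" "X0 - ?E"] by auto
  moreover have "orbit G (\<lambda>g. restrict (glob_act G g) Z) C \<subseteq> ?E"
    if "C \<in> Z" "finite (orbit G (\<lambda>g. restrict (glob_act G g) Z) C)" for C
    using that unfolding orbit_Z[OF that(1)] by (simp add: Z_def)
  ultimately interpret separated_globalization G X \<alpha> A S H Z
    using assms(1,2,3,6) ZX0 X0 inv by unfold_locales auto
  show ?thesis
    using Hausdorff_Ztop S_structure_ZH continuous_action_zact S_preserving_zact
      cofinite_biequivariant_iso_cls finite_orbit_subset topspace_Ztop by blast
qed

end
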